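(* Let $X$ be a second countable topological space (of any cardinality). Then $\mathcal{M}(X)=\mathcal{P}(X)$ if and only if the set of isolated points of $X$ is dense in $X$.
   Context: A point $x\in X$ is isolated if $\{x\}$ is open. For a topological space $X$, a subset $A\subseteq X$ is dense in an open set $U$ if $U\subseteq\overline{A}$, and codense in $U$ if $U\subseteq\overline{X\setminus A}$. A subset $A\subseteq X$ is monitorable if for every non-empty open set $U\subseteq X$ either $A$ is not dense in $U$ or $A$ is not codense in $U$. $\mathcal{M}(X)\subseteq\mathcal{P}(X)$ denotes the family of monitorable subsets of $X$, where $\mathcal{P}(X)$ is the powerset of $X$. *)

theory Defs
  imports "HOL-Analysis.Analysis"
begin

(* Spaces are values of type 'a topology, rather than types of a topological class, so that
   arbitrary (in particular empty) carriers are covered. *)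

definition isolated_points :: "'a topology \<Rightarrow> 'a set" where
  "isolated_points X = {x \<in> topspace X. openin X {x}}"

(* dense_in X A U and codense_in X A U are meant for A \<subseteq> topspace X and U open in X;
   in particular, A is dense in X iff dense_in X A (topspace X). *)

definition dense_in :: "'a topology \<Rightarrow> 'a set \<Rightarrow> 'a set \<Rightarrow> bool" where
  "dense_in X A U \<longleftrightarrow> U \<subseteq> X closure_of A"

definition codense_in :: "'a topology \<Rightarrow> 'a set \<Rightarrow> 'a set \<Rightarrow> bool" where
  "codense_in X A U \<longleftrightarrow> U \<subseteq> X closure_of (topspace X - A)"

definition monitorable :: "'a topology \<Rightarrow> 'a set \<Rightarrow> bool" where
  "monitorable X A \<longleftrightarrow> A \<subseteq> topspace X \<and>
     (\<forall>U. openin X U \<and> U \<noteq> {} \<longrightarrow> \<not> dense_in X A U \<or> \<not> codense_in X A U)"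

definition monitorable_sets :: "'a topology \<Rightarrow> 'a set set" where
  "monitorable_sets X = {A. monitorable X A}"

end

theory Submission
  imports Defs
begin

text \<open>At an isolated point no set is both dense and codense. Conversely, let \<open>U\<close> be a non-empty open
  set without isolated points. If some non-empty open subset of \<open>U\<close> is finite, then a smallest such
  set carries the indiscrete topology and has at least two points, so any of its singletons is dense
  and codense in it. Otherwise all basic open subsets of \<open>U\<close> are infinite, and one picks two points
  from each of these countably many sets, all of them distinct; one point from each pair makes up
  the required set.\<close>

lemma dense_in_iff:
  assumes "openin X U"
  shows "dense_in X A U \<longleftrightarrow> (\<forall>W. openin X W \<and> W \<subseteq> U \<and> W \<noteq> {} \<longrightarrow> W \<inter> A \<noteq> {})"
proof
  assume *: "dense_in X A U"
  show "\<forall>W. openin X W \<and> W \<subseteq> U \<and> W \<noteq> {} \<longrightarrow> W \<inter> A \<noteq> {}"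
  proof (intro allI impI)
    fix W assume W: "openin X W \<and> W \<subseteq> U \<and> W \<noteq> {}"
    then obtain x where "x \<in> W" by blast
    with * W have "x \<in> X closure_of A" unfolding dense_in_def by blast
    with W \<open>x \<in> W\<close> show "W \<inter> A \<noteq> {}" unfolding in_closure_of by blast
  qed
next
  assume *: "\<forall>W. openin X W \<and> W \<subseteq> U \<and> W \<noteq> {} \<longrightarrow> W \<inter> A \<noteq> {}"
  show "dense_in X A U"
    unfolding dense_in_def
  proof
    fix x assume x: "x \<in> U"
    have "\<exists>y. y \<in> A \<and> y \<in> T" if "x \<in> T" "openin X T" for T
    proof -
      \<comment> \<open>Openness of \<open>U\<close> lets any neighbourhood \<open>T\<close> of
        \<open>x\<close> be shrunk to one inside \<open>U\<close>, where the assumption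
        applies.\<close>
      have "openin X (T \<inter> U)" using that assms by blast
      with * x that have "(T \<inter> U) \<inter> A \<noteq> {}" by blast
      then show ?thesis by blast
    qed
    with x openin_subset[OF assms] show "x \<in> X closure_of A"
      unfolding in_closure_of by blast
  qed
qed

text \<open>This removes closures: to refute monitorability, it suffices to find a non-empty open
  \<open>U\<close> all of whose non-empty open subsets meet both \<open>A\<close> and its
  complement.\<close>

lemma monitorable_iff:
  "monitorable X A \<longleftrightarrow> A \<subseteq> topspace X \<and>
    (\<forall>U. openin X U \<and> U \<noteq> {} \<longrightarrow>
      (\<exists>W. openin X W \<and> W \<subseteq> U \<and> W \<noteq> {} \<and> (W \<inter> A = {} \<or> W \<subseteq> A)))"
proof -
  have "codense_in X A U \<longleftrightarrow> (\<forall>W. openin X W \<and> W \<subseteq> U \<and> W \<noteq> {} \<longrightarrow> \<not> W \<subseteq> A)"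
    if "openin X U" for U
  proof -
    have "codense_in X A U \<longleftrightarrow> dense_in X (topspace X - A) U"
      by (simp add: codense_in_def dense_in_def)
    moreover have "W \<inter> (topspace X - A) \<noteq> {} \<longleftrightarrow> \<not> W \<subseteq> A" if "openin X W" for W
      using openin_subset[OF that] by blast
    ultimately show ?thesis
      by (simp add: dense_in_iff[OF that] cong: conj_cong)
  qed
  then have "\<not> dense_in X A U \<or> \<not> codense_in X A U \<longleftrightarrow>
      (\<exists>W. openin X W \<and> W \<subseteq> U \<and> W \<noteq> {} \<and> (W \<inter> A = {} \<or> W \<subseteq> A))"
    if "openin X U" for U
    by (simp only: dense_in_iff[OF that] that) blast
  then show ?thesis
    unfolding monitorable_def by auto
qed

text \<open>The values are chosen recursively: at stage \<open>n\<close> only finitely many points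
  of the infinite set \<open>S n\<close> are already taken. The sets may overlap or even
  coincide.\<close>

lemma ex_inj_choice:
  fixes S :: "nat \<Rightarrow> 'a set"
  assumes "\<And>n. infinite (S n)"
  shows "\<exists>f. inj f \<and> (\<forall>n. f n \<in> S n)"
proof -
  have "\<exists>f. \<forall>n. f n \<in> S n \<and> f n \<notin> f ` {..<n}"
  proof (rule dependent_wellorder_choice)
    \<comment> \<open>The condition on the value at \<open>n\<close> may look at \<open>f\<close>
      only below \<open>n\<close>; this goal checks that, and the next one that a value
      exists.\<close>
    fix r :: 'a and f g :: "nat \<Rightarrow> 'a" and n
    assume "\<And>m. m < n \<Longrightarrow> f m = g m"
    then show "(r \<in> S n \<and> r \<notin> f ` {..<n}) = (r \<in> S n \<and> r \<notin> g ` {..<n})"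
      by auto
  next
    fix n and f :: "nat \<Rightarrow> 'a"
    have "infinite (S n - f ` {..<n})" using assms by simp
    then show "\<exists>r. r \<in> S n \<and> r \<notin> f ` {..<n}" using infinite_imp_nonempty by blast
  qed
  then obtain f where f: "\<And>n. f n \<in> S n" "\<And>n. f n \<notin> f ` {..<n}" by blast
  have "inj f"
  proof (rule linorder_injI)
    fix m n :: nat assume "m < n"
    then have "f m \<in> f ` {..<n}" by blast
    with f(2)[of n] show "f m \<noteq> f n" by metis
  qed
  with f(1) show ?thesis by blast
qed

lemma ex_splitting_set:
  assumes "countable \<B>" and "\<And>B. B \<in> \<B> \<Longrightarrow> infinite B"
  shows "\<exists>A. \<forall>B\<in>\<B>. B \<inter> A \<noteq> {} \<and> \<not> B \<subseteq> A"
proof (cases "\<B> = {}")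
  case False
  \<comment> \<open>Halving the index lists each member at positions \<open>2 * n\<close> and
    \<open>2 * n + 1\<close>, so an injective choice takes two different points from it. The even
    positions form the set, the odd ones witness its complement. Further repetitions in the
    enumeration are harmless.\<close>
  define S where "S n = from_nat_into \<B> (n div 2)" for n
  have "infinite (S n)" for n
    using assms(2) from_nat_into[OF False] by (simp add: S_def)
  then obtain f where f: "inj f" "\<And>n. f n \<in> S n" using ex_inj_choice by metis
  let ?A = "f ` {n. even n}"
  have "B \<inter> ?A \<noteq> {} \<and> \<not> B \<subseteq> ?A" if B: "B \<in> \<B>" for B
  proof -
    obtain n where n: "B = from_nat_into \<B> n"
      using from_nat_into_surj[OF assms(1) B] by blast
    have "f (2 * n) \<in> B" "f (2 * n + 1) \<in> B"
      using f(2)[of "2 * n"] f(2)[of "2 * n + 1"] by (simp_all add: S_def n)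
    \<comment> \<open>By injectivity, a point chosen at an odd position is never one chosen at an
      even position.\<close>
    moreover have "f (2 * n + 1) \<notin> ?A"
      using f(1) by (auto dest!: injD)
    ultimately show ?thesis by auto
  qed
  then show ?thesis by blast
qed simp

lemma non_monitorable_if_finite_open:
  assumes "openin X V" "finite V" "V \<noteq> {}" "V \<inter> isolated_points X = {}"
  shows "\<exists>A \<subseteq> topspace X. \<not> monitorable X A"
proof -
  let ?\<W> = "{W. openin X W \<and> W \<noteq> {} \<and> W \<subseteq> V}"
  have "finite ?\<W>"
    by (rule finite_subset[of _ "Pow V"]) (use assms(2) in auto)
  moreover have "?\<W> \<noteq> {}" using assms by blast
  ultimately have "\<exists>W\<in>?\<W>. \<forall>W'\<in>?\<W>. W' \<subseteq> W \<longrightarrow> W = W'"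
    by (rule finite_has_minimal)
  then obtain W where W: "openin X W" "W \<noteq> {}" "W \<subseteq> V"
    and min: "\<forall>W'\<in>?\<W>. W' \<subseteq> W \<longrightarrow> W = W'"
    by blast
  \<comment> \<open>By minimality, \<open>W\<close> is its own only non-empty open subset.\<close>
  have eq: "W' = W" if "openin X W'" "W' \<noteq> {}" "W' \<subseteq> W" for W'
    using min W(3) that by blast
  obtain a where a: "a \<in> W" using W(2) by blast
  have "a \<in> topspace X" using openin_subset[OF W(1)] a by blast
  moreover have "\<not> openin X {a}"
    using assms(4) W a \<open>a \<in> topspace X\<close> by (auto simp: isolated_points_def)
  then have "W \<noteq> {a}" using W by blast
  \<comment> \<open>Taking \<open>U = W\<close>, the only candidate subset is \<open>W\<close>
    itself, which contains \<open>a\<close> but also another point.\<close>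
  then have "\<not> monitorable X {a}"
    using W(1,2) a eq unfolding monitorable_iff by blast
  ultimately show ?thesis by blast
qed

lemma non_monitorable_if_infinite_open:
  assumes "second_countable X" "openin X V" "V \<noteq> {}"
    and inf: "\<And>W. openin X W \<Longrightarrow> W \<subseteq> V \<Longrightarrow> W \<noteq> {} \<Longrightarrow> infinite W"
  shows "\<exists>A \<subseteq> topspace X. \<not> monitorable X A"
proof -
  obtain \<B> where \<B>: "countable \<B>" "\<And>B. B \<in> \<B> \<Longrightarrow> openin X B"
    "\<And>U x. openin X U \<Longrightarrow> x \<in> U \<Longrightarrow> \<exists>B\<in>\<B>. x \<in> B \<and> B \<subseteq> U"
    using assms(1) by (auto simp: second_countable_def)
  define \<C> where "\<C> = {B \<in> \<B>. B \<subseteq> V \<and> B \<noteq> {}}"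
  have "countable \<C>" using \<B>(1) by (auto simp: \<C>_def)
  moreover have "infinite B" if "B \<in> \<C>" for B
    using that inf \<B>(2) by (auto simp: \<C>_def)
  ultimately obtain A where A: "\<And>B. B \<in> \<C> \<Longrightarrow> B \<inter> A \<noteq> {} \<and> \<not> B \<subseteq> A"
    using ex_splitting_set by metis
  \<comment> \<open>Every non-empty open subset of \<open>V\<close> contains a member of the family
    just split, so it is split too. Intersecting with \<open>topspace X\<close> discards points of
    \<open>A\<close> outside the space.\<close>
  have "W \<inter> (topspace X \<inter> A) \<noteq> {} \<and> \<not> W \<subseteq> topspace X \<inter> A"
    if W: "openin X W" "W \<subseteq> V" "W \<noteq> {}" for W
  proof -
    obtain x where "x \<in> W" using W(3) by blast
    then obtain B where "B \<in> \<B>" "x \<in> B" "B \<subseteq> W"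
      using \<B>(3)[OF W(1)] by blast
    with W(2) have "B \<in> \<C>" by (auto simp: \<C>_def)
    with \<open>B \<subseteq> W\<close> A[of B] openin_subset[OF W(1)] show ?thesis by blast
  qed
  then have "\<not> monitorable X (topspace X \<inter> A)"
    using assms(2,3) unfolding monitorable_iff by blast
  then show ?thesis by blast
qed

theorem proposition3p2:
  fixes X :: "'a topology"
  assumes "second_countable X"
  shows "monitorable_sets X = Pow (topspace X) \<longleftrightarrow> dense_in X (isolated_points X) (topspace X)"
proof
  assume all: "monitorable_sets X = Pow (topspace X)"
  then have all: "\<not> (\<exists>A \<subseteq> topspace X. \<not> monitorable X A)"
    by (auto simp: monitorable_sets_def)
  have "V \<inter> isolated_points X \<noteq> {}" if V: "openin X V" "V \<noteq> {}" for V
  proof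
    assume no_iso: "V \<inter> isolated_points X = {}"
    \<comment> \<open>Open subsets of \<open>V\<close> also lack isolated points, so a finite
      non-empty one would already yield a non-monitorable set.\<close>
    have "infinite W" if "openin X W" "W \<subseteq> V" "W \<noteq> {}" for W
      using non_monitorable_if_finite_open[of X W] all that no_iso by blast
    then show False
      using non_monitorable_if_infinite_open[OF assms V] all by blast
  qed
  then show "dense_in X (isolated_points X) (topspace X)"
    by (simp add: dense_in_iff)
next
  assume "dense_in X (isolated_points X) (topspace X)"
  then have iso: "U \<inter> isolated_points X \<noteq> {}" if "openin X U" "U \<noteq> {}" for U
    using that openin_subset[of X U] by (simp add: dense_in_iff)
  have "monitorable X A" if "A \<subseteq> topspace X" for A
    unfolding monitorable_iff
  proof (intro conjI allI impI)
    fix U assume "openin X U \<and> U \<noteq> {}"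
    then obtain x where "x \<in> U" "openin X {x}"
      using iso[of U] by (auto simp: isolated_points_def)
    \<comment> \<open>A singleton either lies in \<open>A\<close> or misses it, so an open one
      inside \<open>U\<close> always serves as \<open>W\<close>.\<close>
    then show "\<exists>W. openin X W \<and> W \<subseteq> U \<and> W \<noteq> {} \<and> (W \<inter> A = {} \<or> W \<subseteq> A)"
      by (intro exI[of _ "{x}"]) auto
  qed (fact that)
  then show "monitorable_sets X = Pow (topspace X)"
    by (auto simp: monitorable_sets_def monitorable_def)
qed

end
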